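(* For all real $x>0$ and $k>0$, $$\beta_k(x)=\sum_{n=0}^\infty\frac{(-1)^n}{x+nk}.$$
   Context: For $k>0$ and $x>0$, the Nielsen $k$-beta function is $\beta_k(x)=\int_0^1\frac{t^{x-1}}{1+t^k}\,dt$. *)

theory Defs
  imports "HOL-Analysis.Analysis"
begin

text \<open>
  The integral may be improper at \<open>t = 0\<close>; the integrand is nonnegative, so the gauge
  integral used here agrees with the improper Riemann and the Lebesgue integral.  The value
  of the integrand at the single point \<open>t = 0\<close>, where \<open>0 powr a = 0\<close>, is irrelevant.
\<close>

definition nielsen_beta :: "real \<Rightarrow> real \<Rightarrow> real" where
  "nielsen_beta k x = integral {0..1} (\<lambda>t. t powr (x - 1) / (1 + t powr k))"

end

theory Submission
  imports Defs
begin

text \<open>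
  Expanding the integrand as a geometric series in \<open>- (t powr k)\<close>, the partial sums are bounded
  by \<open>2 * t powr (x - 1)\<close> on the open unit interval and their integrals are the partial sums of
  the series, so dominated convergence applies.
\<close>

text \<open>Each summand is \<open>t powr (x - 1)\<close> times a power of the ratio
  \<open>- (t powr k)\<close>. The closed form serves twice: it yields a bound uniform in
  \<open>N\<close> and the pointwise limit.\<close>

lemma sum_powr_geometric:
  fixes k x t :: real
  assumes "t > 0"
  shows "(\<Sum>n<N. (-1) ^ n * t powr (x + real n * k - 1))
    = t powr (x - 1) * ((1 - (- (t powr k)) ^ N) / (1 + t powr k))"
proof -
  have "(-1) ^ n * t powr (x + real n * k - 1) = t powr (x - 1) * (- (t powr k)) ^ n" for n
  proof -
    have "t powr (x + real n * k - 1) = t powr (x - 1) * (t powr k) powr real n"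
      by (simp add: powr_powr flip: powr_add) (simp add: algebra_simps)
    \<comment> \<open>Positivity of \<open>t\<close> turns the real exponent \<open>real n\<close>
      into a natural power; for base 0 the two differ at \<open>n = 0\<close>, since
      \<open>0 powr 0 = 0\<close> but \<open>0 ^ 0 = 1\<close>.\<close>
    then show ?thesis
      using assms by (simp add: powr_realpow power_minus[of "t powr k"])
  qed
  moreover have "(\<Sum>n<N. (- (t powr k)) ^ n) = (1 - (- (t powr k)) ^ N) / (1 + t powr k)"
  proof -
    have "- (t powr k) \<noteq> 1"
      using powr_ge_zero[of t k] by linarith
    then show ?thesis
      by (simp add: sum_gp_strict)
  qed
  ultimately show ?thesis
    by (simp flip: sum_distrib_left)
qed

lemma has_integral_sum_powr:
  fixes k x :: real
  assumes "x > 0" and "k > 0"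
  shows "((\<lambda>t. \<Sum>n<N. (-1) ^ n * t powr (x + real n * k - 1))
    has_integral (\<Sum>n<N. (-1) ^ n / (x + real n * k))) {0<..<1}"
proof (rule has_integral_sum)
  fix n
  \<comment> \<open>This makes the exponent \<open>x + real n * k - 1\<close> exceed -1, the
    condition for integrability at 0.\<close>
  have "x + real n * k > 0"
    using assms by (simp add: add_pos_nonneg)
  then have "((\<lambda>t. t powr (x + real n * k - 1)) has_integral 1 / (x + real n * k)) {0..1}"
    using has_integral_powr_from_0[of "x + real n * k - 1" 1] by simp
  then have "((\<lambda>t. (-1) ^ n * t powr (x + real n * k - 1))
      has_integral (-1) ^ n * (1 / (x + real n * k))) {0..1}"
    by (rule has_integral_mult_right)
  then show "((\<lambda>t. (-1) ^ n * t powr (x + real n * k - 1))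
      has_integral (-1) ^ n / (x + real n * k)) {0<..<1}"
    by (simp add: has_integral_Icc_iff_Ioo)
qed simp

theorem theorem5p2:
  fixes k x :: real
  assumes "x > 0" and "k > 0"
  shows "(\<lambda>n. (-1) ^ n / (x + real n * k)) sums nielsen_beta k x"
proof -
  define f where "f N t = (\<Sum>n<N. (-1) ^ n * t powr (x + real n * k - 1))" for N and t :: real
  let ?g = "\<lambda>t. t powr (x - 1) / (1 + t powr k)"
  have f_int: "(f N has_integral (\<Sum>n<N. (-1) ^ n / (x + real n * k))) {0<..<1}" for N
    unfolding f_def using assms by (rule has_integral_sum_powr)
  \<comment> \<open>The interval is open because at \<open>t = 1\<close> the partial sums alternate
    between 0 and 1, while the integrand is 1/2 there.\<close>
  have "(\<lambda>N. integral {0<..<1} (f N)) \<longlonglongrightarrow> integral {0<..<1} ?g"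
  proof (rule dominated_convergence(2))
    show "f N integrable_on {0<..<1}" for N
      using f_int by (rule has_integral_integrable)
    have "((\<lambda>t. t powr (x - 1)) has_integral 1 / x) {0..1}"
      using has_integral_powr_from_0[of "x - 1" 1] assms by simp
    then show "(\<lambda>t. 2 * t powr (x - 1)) integrable_on {0<..<1}"
      by (intro integrable_on_mult_right)
        (auto simp: has_integral_Icc_iff_Ioo intro: has_integral_integrable)
  next
    fix N and t :: real
    assume t: "t \<in> {0<..<1}"
    have "t powr k \<le> 1"
      using t assms by (simp add: powr_le1)
    then have "\<bar>(- (t powr k)) ^ N\<bar> \<le> 1"
      by (simp add: power_abs power_le_one)
    then have "\<bar>1 - (- (t powr k)) ^ N\<bar> \<le> 2"
      using abs_triangle_ineq4[of 1 "(- (t powr k)) ^ N"] by simp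
    \<comment> \<open>The denominator is at least 1, so dividing by it preserves the bound 2 on the
      numerator.\<close>
    also have "2 \<le> 2 * (1 + t powr k)"
      by simp
    finally have "\<bar>(1 - (- (t powr k)) ^ N) / (1 + t powr k)\<bar> \<le> 2"
      using powr_ge_zero[of t k] by (simp add: abs_divide divide_le_eq add_pos_nonneg)
    from mult_left_mono[OF this powr_ge_zero[of t "x - 1"]]
    show "norm (f N t) \<le> 2 * t powr (x - 1)"
      using t by (simp add: f_def sum_powr_geometric abs_mult)
  next
    fix t :: real
    assume t: "t \<in> {0<..<1}"
    \<comment> \<open>Strictness makes the ratio less than 1 in absolute value, so the remainder
      term of the geometric sum vanishes in the limit.\<close>
    have "t powr k < 1"
      using powr_less_mono2[of k t 1] t assms by simp
    then have "(\<lambda>N. (- (t powr k)) ^ N) \<longlonglongrightarrow> 0"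
      by (intro LIMSEQ_power_zero) simp
    moreover have "1 + t powr k \<noteq> 0"
      using powr_ge_zero[of t k] by linarith
    ultimately have "(\<lambda>N. t powr (x - 1) * ((1 - (- (t powr k)) ^ N) / (1 + t powr k)))
        \<longlonglongrightarrow> t powr (x - 1) * ((1 - 0) / (1 + t powr k))"
      by (intro tendsto_mult tendsto_divide tendsto_diff tendsto_const)
    then show "(\<lambda>N. f N t) \<longlonglongrightarrow> ?g t"
      using t by (simp add: f_def sum_powr_geometric)
  qed
  moreover have "integral {0<..<1} (f N) = (\<Sum>n<N. (-1) ^ n / (x + real n * k))" for N
    using f_int by (rule integral_unique)
  \<comment> \<open>The two endpoints form a null set, so restoring them leaves the integral
    unchanged.\<close>
  moreover have "nielsen_beta k x = integral {0<..<1} ?g"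
    unfolding nielsen_beta_def by (rule integral_open_interval_real)
  ultimately show ?thesis
    by (simp add: sums_def)
qed

end
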